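(* The restriction of the representation $\rho_{10}$ of $so(3,1)$ to the Lie subalgebra $so(3)=\mathrm{span}\{H_3,H_+,H_-\}$ decomposes, up to unitary equivalence, as $$(D_{10},\rho_{10}|_{so(3)})\cong\bigoplus_{s=1}^\infty (E_s,\pi_s),$$ where $s$ runs over the integers $\ge 1$.
   Context: The Lie algebra $so(3,1)\cong sl(2,\mathbb{C})$ of the Lorentz group is considered through its complexification, which has basis $\{H_1,H_2,H_3,F_1,F_2,F_3\}$ and relations $[H_j,H_k]=i\epsilon_{jk\ell}H_\ell$, $[F_j,F_k]=-i\epsilon_{jk\ell}H_\ell$, $[F_j,H_k]=i\epsilon_{jk\ell}F_\ell$ (summation over $\ell$; $\epsilon_{jk\ell}$ is the Levi-Civita symbol), with the involution making these six elements hermitian. Put $H_\pm=H_1\pm iH_2$ and $F_\pm=F_1\pm iF_2$. Let $D_{10}=\mathrm{span}\{\xi_{\ell m}:\ \ell=1,2,3,\ldots,\ m=-\ell,-\ell+1,\ldots,\ell\}$ be the complex pre-Hilbert space (algebraic linear span) for which the $\xi_{\ell m}$ form an orthonormal system. For $\ell\ge 1$ set $C_\ell=i\sqrt{\frac{\ell^2-1}{4\ell^2-1}}$. The representation $\rho_{10}$ acts on $D_{10}$ by $$\rho_{10}(H_3)\xi_{\ell m}=m\,\xi_{\ell m},\qquad \rho_{10}(H_\pm)\xi_{\ell m}=\sqrt{(\ell\mp m)(\ell\pm m+1)}\,\xi_{\ell,m\pm1},$$ $$\rho_{10}(F_3)\xi_{\ell m}=C_\ell\sqrt{\ell^2-m^2}\,\xi_{\ell-1,m}-C_{\ell+1}\sqrt{(\ell+1)^2-m^2}\,\xi_{\ell+1,m},$$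 $$\rho_{10}(F_\pm)\xi_{\ell m}=\pm C_\ell\sqrt{(\ell\mp m)(\ell\mp m-1)}\,\xi_{\ell-1,m\pm1}\pm C_{\ell+1}\sqrt{(\ell\pm m+1)(\ell\pm m+2)}\,\xi_{\ell+1,m\pm1},$$ where terms with vanishing coefficient are omitted (in particular $C_1=0$). For $s\in\frac12\mathbb{Z}$, $s\ge0$, $E_s=\mathrm{span}\{e_{-s},e_{-s+1},\ldots,e_s\}$ with $e_{-s},\ldots,e_s$ orthonormal, and $\pi_s$ is the irreducible representation of $so(3)$ on $E_s$ given by $\pi_s(H_3)e_m=m\,e_m$, $\pi_s(H_\pm)e_m=\sqrt{(s\mp m)(s\pm m+1)}\,e_{m\pm1}$ for $m=-s,\ldots,s$. The direct sum is the algebraic orthogonal direct sum; $\cong$ means existence of an inner-product-preserving linear bijection intertwining the actions. *)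

theory Defs
  imports "HOL-Analysis.Analysis" "HOL-Library.Poly_Mapping"
begin

text \<open>The pair \<open>(a, b)\<close> stands for \<open>\<Sum>j. a\<^sub>j H\<^sub>j + b\<^sub>j F\<^sub>j\<close>. The components of \<open>complex ^ 3\<close> are
  indexed by \<open>1, 2, 3 :: 3\<close> (where \<open>3 = 0\<close>).\<close>

type_synonym so31 = "(complex ^ 3) \<times> (complex ^ 3)"

definition so31_scale :: "complex \<Rightarrow> so31 \<Rightarrow> so31" where
  "so31_scale c X = (c *s fst X, c *s snd X)"

global_interpretation so31: vector_space so31_scale
  by unfold_locales
    (auto simp: so31_scale_def prod_eq_iff vec_eq_iff algebra_simps)

definition levi_civita :: "3 \<Rightarrow> 3 \<Rightarrow> 3 \<Rightarrow> complex" where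
  "levi_civita j k l =
     (if (j, k, l) \<in> {(1, 2, 3), (2, 3, 1), (3, 1, 2)} then 1
      else if (j, k, l) \<in> {(1, 3, 2), (3, 2, 1), (2, 1, 3)} then -1 else 0)"

definition so31_H :: "3 \<Rightarrow> so31" where "so31_H j = (axis j 1, 0)"
definition so31_F :: "3 \<Rightarrow> so31" where "so31_F j = (0, axis j 1)"

definition so31_bracket :: "so31 \<Rightarrow> so31 \<Rightarrow> so31" where
  "so31_bracket X Y =
     ((\<chi> l. \<Sum>j\<in>UNIV. \<Sum>k\<in>UNIV.
         \<i> * levi_civita j k l * (fst X $ j * fst Y $ k - snd X $ j * snd Y $ k)),
      (\<chi> l. \<Sum>j\<in>UNIV. \<Sum>k\<in>UNIV.
         \<i> * levi_civita j k l * (fst X $ j * snd Y $ k + snd X $ j * fst Y $ k)))"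

lemma so31_relations:
  "so31_bracket (so31_H j) (so31_H k) = (\<Sum>l\<in>UNIV. so31_scale (\<i> * levi_civita j k l) (so31_H l))"
  "so31_bracket (so31_F j) (so31_F k) = (\<Sum>l\<in>UNIV. so31_scale (- \<i> * levi_civita j k l) (so31_H l))"
  "so31_bracket (so31_F j) (so31_H k) = (\<Sum>l\<in>UNIV. so31_scale (\<i> * levi_civita j k l) (so31_F l))"
  unfolding atomize_conj
  using exhaust_3[of j] exhaust_3[of k]
  by (elim disjE; hypsubst)
    (simp_all add: so31_bracket_def so31_H_def so31_F_def so31_scale_def levi_civita_def
      prod_eq_iff vec_eq_iff forall_3 sum_3 axis_def)

definition so31_Hp :: so31 where "so31_Hp = so31_H 1 + so31_scale \<i> (so31_H 2)"
definition so31_Hm :: so31 where "so31_Hm = so31_H 1 - so31_scale \<i> (so31_H 2)"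

definition so3 :: "so31 set" where
  "so3 = so31.span {so31_H 3, so31_Hp, so31_Hm}"

text \<open>A pre-Hilbert space is a subset (\<open>carrier\<close>) of an additive group, with its scalar
  multiplication and inner product; \<open>alg\<close> is the Lie algebra that acts.\<close>

record ('g, 'v) rep =
  alg :: "'g set"
  carrier :: "'v set"
  scale :: "complex \<Rightarrow> 'v \<Rightarrow> 'v"
  inner_prod :: "'v \<Rightarrow> 'v \<Rightarrow> complex"
  act :: "'g \<Rightarrow> 'v \<Rightarrow> 'v"

definition restrict_rep :: "'g set \<Rightarrow> ('g, 'v) rep \<Rightarrow> ('g, 'v) rep" where
  "restrict_rep L R = R\<lparr>alg := L\<rparr>"

definition unitarily_equivalent ::
    "('g, 'v::ab_group_add) rep \<Rightarrow> ('g, 'w::ab_group_add) rep \<Rightarrow> bool" (infix "\<cong>\<^sub>u" 50) where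
  "R \<cong>\<^sub>u S \<longleftrightarrow> alg R = alg S \<and>
     (\<exists>U. bij_betw U (carrier R) (carrier S) \<and>
       (\<forall>v\<in>carrier R. \<forall>w\<in>carrier R. U (v + w) = U v + U w) \<and>
       (\<forall>c. \<forall>v\<in>carrier R. U (scale R c v) = scale S c (U v)) \<and>
       (\<forall>v\<in>carrier R. \<forall>w\<in>carrier R. inner_prod S (U v) (U w) = inner_prod R v w) \<and>
       (\<forall>X\<in>alg R. \<forall>v\<in>carrier R. U (act R X v) = act S X (U v)))"

text \<open>The algebraic orthogonal direct sum: families with finitely many nonzero members.\<close>

definition direct_sum :: "'i set \<Rightarrow> ('i \<Rightarrow> ('g, 'v::ab_group_add) rep) \<Rightarrow> ('g, 'i \<Rightarrow>\<^sub>0 'v) rep" where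
  "direct_sum I R = \<lparr>
     alg = (\<Inter>i\<in>I. alg (R i)),
     carrier = {v. Poly_Mapping.keys v \<subseteq> I \<and> (\<forall>i\<in>I. poly_mapping.lookup v i \<in> carrier (R i))},
     scale = (\<lambda>c. Poly_Mapping.mapp (\<lambda>i. scale (R i) c)),
     inner_prod = (\<lambda>v w. \<Sum>i\<in>Poly_Mapping.keys v. inner_prod (R i) (poly_mapping.lookup v i) (poly_mapping.lookup w i)),
     act = (\<lambda>X. Poly_Mapping.mapp (\<lambda>i. act (R i) X))\<rparr>"

text \<open>Vectors are finitely supported functions on the index type, and \<open>Poly_Mapping.single k 1\<close>
  is the basis vector with index \<open>k\<close>.\<close>

definition pm_scale :: "complex \<Rightarrow> ('k \<Rightarrow>\<^sub>0 complex) \<Rightarrow> ('k \<Rightarrow>\<^sub>0 complex)" where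
  "pm_scale c v = Poly_Mapping.map (\<lambda>x. c * x) v"

lemma lookup_pm_scale [simp]: "poly_mapping.lookup (pm_scale c v) k = c * poly_mapping.lookup v k"
  by (simp add: pm_scale_def Poly_Mapping.map.rep_eq when_def)

global_interpretation pm: vector_space pm_scale
  by unfold_locales (auto intro!: poly_mapping_eqI simp: lookup_add algebra_simps)

definition pm_inner :: "('k \<Rightarrow>\<^sub>0 complex) \<Rightarrow> ('k \<Rightarrow>\<^sub>0 complex) \<Rightarrow> complex" where
  "pm_inner v w = (\<Sum>k\<in>Poly_Mapping.keys v. poly_mapping.lookup v k * cnj (poly_mapping.lookup w k))"

lemma pm_inner_single:
  "pm_inner (Poly_Mapping.single j 1) (Poly_Mapping.single k 1) = (if j = k then 1 else 0)"
  by (simp add: pm_inner_def lookup_single when_def)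

definition lin_ext :: "('k \<Rightarrow> ('k \<Rightarrow>\<^sub>0 complex)) \<Rightarrow> ('k \<Rightarrow>\<^sub>0 complex) \<Rightarrow> ('k \<Rightarrow>\<^sub>0 complex)" where
  "lin_ext f v = (\<Sum>k\<in>Poly_Mapping.keys v. pm_scale (poly_mapping.lookup v k) (f k))"

text \<open>The action of \<open>a\<^sub>1 H\<^sub>1 + a\<^sub>2 H\<^sub>2 + a\<^sub>3 H\<^sub>3\<close> given the actions of \<open>H\<^sub>+\<close>, \<open>H\<^sub>-\<close>, \<open>H\<^sub>3\<close>, obtained from
  \<open>H\<^sub>1 = (H\<^sub>+ + H\<^sub>-) / 2\<close> and \<open>H\<^sub>2 = (H\<^sub>+ - H\<^sub>-) / (2\<i>)\<close>; likewise for the \<open>F\<^sub>j\<close>.\<close>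

definition triple_act :: "('v \<Rightarrow> ('k \<Rightarrow>\<^sub>0 complex)) \<Rightarrow> ('v \<Rightarrow> ('k \<Rightarrow>\<^sub>0 complex)) \<Rightarrow> ('v \<Rightarrow> ('k \<Rightarrow>\<^sub>0 complex)) \<Rightarrow>
    complex ^ 3 \<Rightarrow> 'v \<Rightarrow> ('k \<Rightarrow>\<^sub>0 complex)" where
  "triple_act Tp Tm T3 a v =
     pm_scale (a $ 1) (pm_scale (1 / 2) (Tp v + Tm v)) +
     pm_scale (a $ 2) (pm_scale (1 / (2 * \<i>)) (Tp v - Tm v)) +
     pm_scale (a $ 3) (T3 v)"

type_synonym D_vec = "int \<times> int \<Rightarrow>\<^sub>0 complex"

definition xi :: "int \<Rightarrow> int \<Rightarrow> D_vec" where
  "xi l m = Poly_Mapping.single (l, m) 1"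

definition D10 :: "D_vec set" where
  "D10 = pm.span {xi l m | l m. 1 \<le> l \<and> - l \<le> m \<and> m \<le> l}"

definition C10 :: "int \<Rightarrow> complex" where
  "C10 l = \<i> * complex_of_real (sqrt ((of_int l ^ 2 - 1) / (4 * of_int l ^ 2 - 1)))"

definition csqrt_int :: "int \<Rightarrow> complex" where
  "csqrt_int n = complex_of_real (sqrt (real_of_int n))"

text \<open>For admissible \<open>(l, m)\<close>, every term below whose index is not admissible has coefficient
  zero (see \<open>rho10_act_in_D10\<close>).\<close>

definition rho10_H3 :: "D_vec \<Rightarrow> D_vec" where
  "rho10_H3 = lin_ext (\<lambda>(l, m). pm_scale (of_int m) (xi l m))"

definition rho10_Hp :: "D_vec \<Rightarrow> D_vec" where
  "rho10_Hp = lin_ext (\<lambda>(l, m). pm_scale (csqrt_int ((l - m) * (l + m + 1))) (xi l (m + 1)))"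

definition rho10_Hm :: "D_vec \<Rightarrow> D_vec" where
  "rho10_Hm = lin_ext (\<lambda>(l, m). pm_scale (csqrt_int ((l + m) * (l - m + 1))) (xi l (m - 1)))"

definition rho10_F3 :: "D_vec \<Rightarrow> D_vec" where
  "rho10_F3 = lin_ext (\<lambda>(l, m).
     pm_scale (C10 l * csqrt_int (l ^ 2 - m ^ 2)) (xi (l - 1) m)
     - pm_scale (C10 (l + 1) * csqrt_int ((l + 1) ^ 2 - m ^ 2)) (xi (l + 1) m))"

definition rho10_Fp :: "D_vec \<Rightarrow> D_vec" where
  "rho10_Fp = lin_ext (\<lambda>(l, m).
     pm_scale (C10 l * csqrt_int ((l - m) * (l - m - 1))) (xi (l - 1) (m + 1))
     + pm_scale (C10 (l + 1) * csqrt_int ((l + m + 1) * (l + m + 2))) (xi (l + 1) (m + 1)))"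

definition rho10_Fm :: "D_vec \<Rightarrow> D_vec" where
  "rho10_Fm = lin_ext (\<lambda>(l, m).
     - pm_scale (C10 l * csqrt_int ((l + m) * (l + m - 1))) (xi (l - 1) (m - 1))
     - pm_scale (C10 (l + 1) * csqrt_int ((l - m + 1) * (l - m + 2))) (xi (l + 1) (m - 1)))"

definition rho10 :: "(so31, D_vec) rep" where
  "rho10 = \<lparr>
     alg = UNIV,
     carrier = D10,
     scale = pm_scale,
     inner_prod = pm_inner,
     act = (\<lambda>X v. triple_act rho10_Hp rho10_Hm rho10_H3 (fst X) v
                + triple_act rho10_Fp rho10_Fm rho10_F3 (snd X) v)\<rparr>"

text \<open>The spin \<open>s\<close> is meant to be a nonnegative element of \<open>\<onehalf>\<int>\<close>; weights are real numbers, since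
  they are half-integers in general.\<close>

type_synonym E_vec = "real \<Rightarrow>\<^sub>0 complex"

definition e_vec :: "real \<Rightarrow> E_vec" where
  "e_vec m = Poly_Mapping.single m 1"

definition weights :: "real \<Rightarrow> real set" where
  "weights s = {m. m \<le> s \<and> (\<exists>k::nat. m = - s + real k)}"

definition E_space :: "real \<Rightarrow> E_vec set" where
  "E_space s = pm.span (e_vec ` weights s)"

definition pi_H3 :: "E_vec \<Rightarrow> E_vec" where
  "pi_H3 = lin_ext (\<lambda>m. pm_scale (complex_of_real m) (e_vec m))"

definition pi_Hp :: "real \<Rightarrow> E_vec \<Rightarrow> E_vec" where
  "pi_Hp s = lin_ext (\<lambda>m. pm_scale (complex_of_real (sqrt ((s - m) * (s + m + 1)))) (e_vec (m + 1)))"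

definition pi_Hm :: "real \<Rightarrow> E_vec \<Rightarrow> E_vec" where
  "pi_Hm s = lin_ext (\<lambda>m. pm_scale (complex_of_real (sqrt ((s + m) * (s - m + 1)))) (e_vec (m - 1)))"

text \<open>Elements of \<open>so3\<close> have no \<open>F\<close>-components (see \<open>so3_eq\<close>).\<close>

definition pi_rep :: "real \<Rightarrow> (so31, E_vec) rep" where
  "pi_rep s = \<lparr>
     alg = so3,
     carrier = E_space s,
     scale = pm_scale,
     inner_prod = pm_inner,
     act = (\<lambda>X. triple_act (pi_Hp s) (pi_Hm s) pi_H3 (fst X))\<rparr>"

lemma so3_eq: "so3 = {X. snd X = 0}"
proof
  have "so31.subspace {X :: so31. snd X = 0}"
    by (auto simp: so31.subspace_def so31_scale_def)
  then show "so3 \<subseteq> {X. snd X = 0}"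
    unfolding so3_def
    by (intro so31.span_minimal)
      (auto simp: so31_H_def so31_Hp_def so31_Hm_def so31_scale_def)
next
  show "{X. snd X = 0} \<subseteq> so3"
  proof safe
    fix a b :: "complex ^ 3" assume b: "snd (a, b) = 0"
    have "(a, b) = so31_scale (a $ 3) (so31_H 3)
        + so31_scale ((a $ 1 - \<i> * a $ 2) / 2) so31_Hp
        + so31_scale ((a $ 1 + \<i> * a $ 2) / 2) so31_Hm"
      using b by (simp add: so31_H_def so31_Hp_def so31_Hm_def so31_scale_def
          prod_eq_iff vec_eq_iff forall_3 axis_def field_simps)
    also have "\<dots> \<in> so3"
      unfolding so3_def
      by (intro so31.span_add so31.span_scale so31.span_base) auto
    finally show "(a, b) \<in> so3" .
  qed
qed

lemma so3_subalgebra: "X \<in> so3 \<Longrightarrow> Y \<in> so3 \<Longrightarrow> so31_bracket X Y \<in> so3"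
  by (auto simp: so3_eq so31_bracket_def vec_eq_iff)

lemma keys_span_single:
  assumes "v \<in> pm.span ((\<lambda>k. Poly_Mapping.single k 1) ` K)"
  shows "Poly_Mapping.keys v \<subseteq> K"
proof -
  have "pm.subspace {v :: 'a \<Rightarrow>\<^sub>0 complex. Poly_Mapping.keys v \<subseteq> K}"
    by (auto simp: pm.subspace_def subset_eq in_keys_iff lookup_add)
  moreover have "(\<lambda>k. Poly_Mapping.single k (1::complex)) ` K \<subseteq> {v. Poly_Mapping.keys v \<subseteq> K}"
    by auto
  ultimately show ?thesis
    using assms pm.span_minimal by blast
qed

lemma lin_ext_in_span:
  assumes "v \<in> pm.span ((\<lambda>k. Poly_Mapping.single k 1) ` K)"
    and "\<And>k. k \<in> K \<Longrightarrow> f k \<in> pm.span B"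
  shows "lin_ext f v \<in> pm.span B"
  unfolding lin_ext_def
  using keys_span_single[OF assms(1)] assms(2)
  by (intro pm.span_sum pm.span_scale) auto

lemma triple_act_in_span:
  assumes "Tp v \<in> pm.span B" "Tm v \<in> pm.span B" "T3 v \<in> pm.span B"
  shows "triple_act Tp Tm T3 a v \<in> pm.span B"
  unfolding triple_act_def
  using assms by (intro pm.span_add pm.span_scale pm.span_diff)

lemma D10_eq:
  "D10 = pm.span ((\<lambda>k. Poly_Mapping.single k 1) ` {(l, m). 1 \<le> l \<and> - l \<le> m \<and> m \<le> l})"
  unfolding D10_def xi_def by (rule arg_cong[where f = pm.span]) auto

lemma scale_xi_in_D10:
  assumes "c \<noteq> 0 \<Longrightarrow> 1 \<le> l \<and> - l \<le> m \<and> m \<le> l"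
  shows "pm_scale c (xi l m) \<in> D10"
proof (cases "c = 0")
  case True
  then show ?thesis by (simp add: D10_def pm.span_zero)
next
  case False
  with assms show ?thesis
    unfolding D10_def by (intro pm.span_scale pm.span_base) auto
qed

lemma C10_1 [simp]: "C10 1 = 0"
  by (simp add: C10_def)

lemma csqrt_int_eq_0 [simp]: "csqrt_int n = 0 \<longleftrightarrow> n = 0"
  by (simp add: csqrt_int_def)

lemma rho10_act_in_D10:
  assumes "v \<in> D10"
  shows "act rho10 X v \<in> D10"
proof -
  have lin: "lin_ext f v \<in> D10"
    if "\<And>l m. 1 \<le> l \<Longrightarrow> - l \<le> m \<Longrightarrow> m \<le> l \<Longrightarrow> f (l, m) \<in> D10" for f
    using assms that unfolding D10_eq by (intro lin_ext_in_span) auto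
  have add: "x + y \<in> D10" and sub: "x - y \<in> D10" if "x \<in> D10" "y \<in> D10" for x y
    using that unfolding D10_def by (auto intro: pm.span_add pm.span_diff)
  have neg: "- x \<in> D10" if "x \<in> D10" for x
    using that unfolding D10_def by (rule pm.span_neg)
  have 1: "l = 1 \<or> l \<ge> 2" if "1 \<le> l" for l :: int using that by auto
  have sq: "l ^ 2 - m ^ 2 = (l - m) * (l + m)" for l m :: int
    by (simp add: power2_eq_square algebra_simps)
  have "rho10_Hp v \<in> D10" "rho10_Hm v \<in> D10" "rho10_H3 v \<in> D10"
    unfolding rho10_Hp_def rho10_Hm_def rho10_H3_def
    by (auto intro!: lin scale_xi_in_D10)
  moreover have "rho10_F3 v \<in> D10"
    unfolding rho10_F3_def
    by (auto intro!: lin sub scale_xi_in_D10 simp: sq dest!: 1)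
  moreover have "rho10_Fp v \<in> D10"
    unfolding rho10_Fp_def
    by (auto intro!: lin add scale_xi_in_D10 dest!: 1)
  moreover have "rho10_Fm v \<in> D10"
    unfolding rho10_Fm_def
    by (auto intro!: lin sub neg scale_xi_in_D10 dest!: 1)
  ultimately show ?thesis
    unfolding rho10_def rep.simps D10_def by (intro pm.span_add triple_act_in_span)
qed

lemma pi_act_in_E_space:
  assumes "v \<in> E_space s" and "2 * s \<in> \<int>"
  shows "act (pi_rep s) X v \<in> E_space s"
proof -
  have sc: "pm_scale c (e_vec m) \<in> E_space s" if "c \<noteq> 0 \<Longrightarrow> m \<in> weights s" for c m
  proof (cases "c = 0")
    case True
    then show ?thesis by (simp add: E_space_def pm.span_zero)
  next
    case False
    with that show ?thesis
      unfolding E_space_def by (intro pm.span_scale pm.span_base) auto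
  qed
  have lin: "lin_ext f v \<in> E_space s" if "\<And>m. m \<in> weights s \<Longrightarrow> f m \<in> E_space s" for f
    using assms(1) that unfolding E_space_def e_vec_def by (intro lin_ext_in_span) auto
  have up: "m + 1 \<in> weights s" if "m \<in> weights s" "m \<noteq> s" and sm: "s - m \<in> \<int>" for m
  proof -
    from that obtain k :: nat where "m = - s + real k" "m < s"
      by (auto simp: weights_def)
    moreover obtain i :: int where "s - m = of_int i"
      using sm by (elim Ints_cases)
    moreover from this \<open>m < s\<close> have "i \<ge> 1" by linarith
    ultimately have "m + 1 \<le> s" by linarith
    with \<open>m = - s + real k\<close> show ?thesis
      by (auto simp: weights_def intro!: exI[of _ "Suc k"])
  qed
  have down: "m - 1 \<in> weights s" if "m \<in> weights s" "s + m \<noteq> 0" for m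
  proof -
    from that obtain k :: nat where k: "m = - s + real k" "m \<le> s"
      by (auto simp: weights_def)
    with that(2) obtain k' where "k = Suc k'" by (cases k) auto
    with k show ?thesis by (auto simp: weights_def)
  qed
  have int: "s - m \<in> \<int>" if "m \<in> weights s" for m
  proof -
    obtain j :: int where j: "2 * s = of_int j" using assms(2) by (elim Ints_cases)
    from that obtain k :: nat where "m = - s + real k" by (auto simp: weights_def)
    with j have "s - m = of_int (j - int k)" by simp
    then show ?thesis by (metis Ints_of_int)
  qed
  have top: "s + m + 1 \<noteq> 0" "s - m + 1 \<noteq> 0" if "m \<in> weights s" for m
    using that by (auto simp: weights_def)
  have "pi_H3 v \<in> E_space s" "pi_Hp s v \<in> E_space s" "pi_Hm s v \<in> E_space s"
    unfolding pi_H3_def pi_Hp_def pi_Hm_def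
    by (intro lin sc; use up down int top in auto)+
  then show ?thesis
    unfolding pi_rep_def rep.simps E_space_def by (intro triple_act_in_span)
qed

end

theory Submission
  imports Defs
begin

text \<open>The formulas for \<open>H\<^sub>3\<close> and \<open>H\<^sub>\<plusminus>\<close> leave the first index \<open>\<ell>\<close> of \<open>\<xi>\<^sub>\<ell>\<^sub>m\<close> fixed, and on the span of
  \<open>\<xi>\<^sub>\<ell>\<^sub>,\<^sub>-\<^sub>\<ell>, \<dots>, \<xi>\<^sub>\<ell>\<^sub>\<ell>\<close> they are those of \<open>\<pi>\<^sub>\<ell>\<close>. So currying, \<open>\<xi>\<^sub>\<ell>\<^sub>m \<mapsto> e\<^sub>m\<close> in the summand \<open>\<ell>\<close>, is
  the equivalence: it only relabels orthonormal bases. All vectors are finitely supported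
  functions, so the work is done in coordinates. Every operator involved sends a basis vector
  to a multiple of a basis vector, injectively on the indices, whence \<open>lookup_lin_ext_monomial\<close>
  gives each coordinate of the image as one coordinate of the argument; the intertwining
  property (\<open>decompose_triple_act\<close>) is then an identity between coefficients, valid for all
  finitely supported functions. The supports matter only for
  bijectivity, where the weights of \<open>\<pi>\<^sub>\<ell>\<close>, a priori real numbers, must be seen to be the integers
  from \<open>-\<ell>\<close> to \<open>\<ell>\<close>.\<close>

section \<open>Coordinates of finitely supported vectors\<close>

lemma lookup_lin_ext_monomial:
  assumes "\<And>k. g k = j \<longleftrightarrow> k = i"
  shows "poly_mapping.lookup (lin_ext (\<lambda>k. pm_scale (c k) (Poly_Mapping.single (g k) 1)) v) j
    = c i * poly_mapping.lookup v i"
proof -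
  have "poly_mapping.lookup (lin_ext (\<lambda>k. pm_scale (c k) (Poly_Mapping.single (g k) 1)) v) j
      = (\<Sum>k\<in>Poly_Mapping.keys v. if k = i then c i * poly_mapping.lookup v i else 0)"
    unfolding lin_ext_def lookup_sum
    by (intro sum.cong) (auto simp: lookup_single assms when_def)
  also have "\<dots> = c i * poly_mapping.lookup v i"
    by (simp add: in_keys_iff)
  finally show ?thesis .
qed

lemma span_single_eq:
  "pm.span ((\<lambda>k. Poly_Mapping.single k 1) ` K) = {v. Poly_Mapping.keys v \<subseteq> K}"
proof safe
  fix v :: "'a \<Rightarrow>\<^sub>0 complex" assume v: "Poly_Mapping.keys v \<subseteq> K"
  have "v = lin_ext (\<lambda>k. pm_scale 1 (Poly_Mapping.single k 1)) v"
    by (rule poly_mapping_eqI) (simp only: lookup_lin_ext_monomial[where g = "\<lambda>k. k"] mult_1)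
  also have "\<dots> \<in> pm.span ((\<lambda>k. Poly_Mapping.single k 1) ` K)"
    unfolding lin_ext_def using v
    by (intro pm.span_sum pm.span_scale pm.span_base) auto
  finally show "v \<in> pm.span ((\<lambda>k. Poly_Mapping.single k 1) ` K)" .
qed (use keys_span_single in blast)

lemma D10_keys: "D10 = {v. Poly_Mapping.keys v \<subseteq> {(l, m). 1 \<le> l \<and> - l \<le> m \<and> m \<le> l}}"
  by (simp only: D10_eq span_single_eq)

lemma weights_of_int: "weights (of_int l) = of_int ` {- l..l}"
proof safe
  fix x :: real assume "x \<in> weights (of_int l)"
  then obtain k :: nat where k: "x = - of_int l + real k" "x \<le> of_int l"
    by (auto simp: weights_def)
  then have "- l + int k \<le> l" by linarith
  with k show "x \<in> of_int ` {- l..l}"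
    by (intro image_eqI[of _ _ "- l + int k"]) auto
next
  fix m :: int assume "m \<in> {- l..l}"
  then show "real_of_int m \<in> weights (of_int l)"
    by (auto simp: weights_def intro!: exI[of _ "nat (m + l)"])
qed

lemma E_space_keys: "E_space (of_int l) = {v. Poly_Mapping.keys v \<subseteq> of_int ` {- l..l}}"
  by (simp only: E_space_def e_vec_def[abs_def] span_single_eq weights_of_int)

lemma lookup_mapp_zero:
  assumes "\<And>i. f i 0 = 0"
  shows "poly_mapping.lookup (Poly_Mapping.mapp f p) i = f i (poly_mapping.lookup p i)"
  by (simp add: lookup_mapp assms when_def in_keys_iff)

lemma lookup_rho10:
  "poly_mapping.lookup (rho10_H3 v) (l, m) = of_int m * poly_mapping.lookup v (l, m)"
  "poly_mapping.lookup (rho10_Hp v) (l, m)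
    = csqrt_int ((l - (m - 1)) * (l + (m - 1) + 1)) * poly_mapping.lookup v (l, m - 1)"
  "poly_mapping.lookup (rho10_Hm v) (l, m)
    = csqrt_int ((l + (m + 1)) * (l - (m + 1) + 1)) * poly_mapping.lookup v (l, m + 1)"
  unfolding rho10_H3_def rho10_Hp_def rho10_Hm_def xi_def
  using lookup_lin_ext_monomial[of "\<lambda>k. k" "(l, m)" "(l, m)" "\<lambda>(l, m). of_int m" v]
    lookup_lin_ext_monomial[of "\<lambda>(l, m). (l, m + 1)" "(l, m)" "(l, m - 1)"
      "\<lambda>(l, m). csqrt_int ((l - m) * (l + m + 1))" v]
    lookup_lin_ext_monomial[of "\<lambda>(l, m). (l, m - 1)" "(l, m)" "(l, m + 1)"
      "\<lambda>(l, m). csqrt_int ((l + m) * (l - m + 1))" v]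
  by (auto simp: case_prod_unfold prod_eq_iff diff_eq_eq eq_diff_eq)

lemma lookup_pi:
  "poly_mapping.lookup (pi_H3 w) x = of_real x * poly_mapping.lookup w x"
  "poly_mapping.lookup (pi_Hp s w) x
    = of_real (sqrt ((s - (x - 1)) * (s + (x - 1) + 1))) * poly_mapping.lookup w (x - 1)"
  "poly_mapping.lookup (pi_Hm s w) x
    = of_real (sqrt ((s + (x + 1)) * (s - (x + 1) + 1))) * poly_mapping.lookup w (x + 1)"
  unfolding pi_H3_def pi_Hp_def pi_Hm_def e_vec_def
  by (rule lookup_lin_ext_monomial; auto)+

lemma lookup_triple_act:
  "poly_mapping.lookup (triple_act Tp Tm T3 a v) k =
     a $ 1 * (1 / 2 * (poly_mapping.lookup (Tp v) k + poly_mapping.lookup (Tm v) k)) +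
     a $ 2 * (1 / (2 * \<i>) * (poly_mapping.lookup (Tp v) k - poly_mapping.lookup (Tm v) k)) +
     a $ 3 * poly_mapping.lookup (T3 v) k"
  by (simp add: triple_act_def lookup_add lookup_minus)

section \<open>Decomposition into components of fixed \<open>\<ell>\<close>\<close>

text \<open>Weights of \<open>E_vec\<close> are real, so a component is extended by zero off the integers.\<close>

definition component :: "D_vec \<Rightarrow> int \<Rightarrow> E_vec" where
  "component v l = Abs_poly_mapping
     (\<lambda>x. if x \<in> \<int> then poly_mapping.lookup v (l, \<lfloor>x\<rfloor>) else 0)"

definition decompose :: "D_vec \<Rightarrow> (int \<Rightarrow>\<^sub>0 E_vec)" where
  "decompose v = Abs_poly_mapping (component v)"

definition recompose :: "(int \<Rightarrow>\<^sub>0 E_vec) \<Rightarrow> D_vec" where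
  "recompose w = Abs_poly_mapping
     (\<lambda>(l, m). poly_mapping.lookup (poly_mapping.lookup w l) (of_int m))"

lemma lookup_component:
  "poly_mapping.lookup (component v l) x
    = (if x \<in> \<int> then poly_mapping.lookup v (l, \<lfloor>x\<rfloor>) else 0)"
proof -
  have "{x::real. (if x \<in> \<int> then poly_mapping.lookup v (l, \<lfloor>x\<rfloor>) else 0) \<noteq> 0}
      \<subseteq> (\<lambda>k. of_int (snd k)) ` Poly_Mapping.keys v"
    by (force simp: in_keys_iff elim!: Ints_cases split: if_splits)
  then have "finite {x::real. (if x \<in> \<int> then poly_mapping.lookup v (l, \<lfloor>x\<rfloor>) else 0) \<noteq> 0}"
    by (rule finite_subset) simp
  then show ?thesis
    by (simp add: component_def lookup_Abs_poly_mapping)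
qed

lemma lookup_decompose: "poly_mapping.lookup (decompose v) = component v"
proof -
  have "{l. component v l \<noteq> 0} \<subseteq> fst ` Poly_Mapping.keys v"
    by (force simp: poly_mapping_eq_iff fun_eq_iff lookup_component in_keys_iff
        split: if_splits)
  then have "finite {l. component v l \<noteq> 0}"
    by (rule finite_subset) simp
  then show ?thesis
    by (simp add: decompose_def lookup_Abs_poly_mapping)
qed

lemma lookup_recompose:
  "poly_mapping.lookup (recompose w) (l, m)
    = poly_mapping.lookup (poly_mapping.lookup w l) (of_int m)"
proof -
  let ?f = "\<lambda>(l, m). poly_mapping.lookup (poly_mapping.lookup w l) (real_of_int m)"
  have "{k. ?f k \<noteq> 0} \<subseteq> (\<lambda>(l, x). (l, \<lfloor>x\<rfloor>)) `
      Sigma (Poly_Mapping.keys w) (\<lambda>l. Poly_Mapping.keys (poly_mapping.lookup w l))"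
  proof
    fix k assume "k \<in> {k. ?f k \<noteq> 0}"
    then show "k \<in> (\<lambda>(l, x). (l, \<lfloor>x\<rfloor>)) `
        Sigma (Poly_Mapping.keys w) (\<lambda>l. Poly_Mapping.keys (poly_mapping.lookup w l))"
      by (intro image_eqI[of _ _ "(fst k, of_int (snd k))"]) (auto simp: in_keys_iff split_def)
  qed
  then have "finite {k. ?f k \<noteq> 0}"
    by (rule finite_subset) auto
  then show ?thesis
    by (simp add: recompose_def lookup_Abs_poly_mapping)
qed

lemma recompose_decompose: "recompose (decompose v) = v"
  by (rule poly_mapping_eqI)
    (auto simp: lookup_recompose lookup_decompose lookup_component)

lemma decompose_recompose:
  assumes "\<And>l. Poly_Mapping.keys (poly_mapping.lookup w l) \<subseteq> \<int>"
  shows "decompose (recompose w) = w"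
proof (intro poly_mapping_eqI)
  fix l x
  have "poly_mapping.lookup (poly_mapping.lookup w l) x = 0" if "x \<notin> \<int>"
    using assms[of l] that by (auto simp: in_keys_iff)
  then show "poly_mapping.lookup (poly_mapping.lookup (decompose (recompose w)) l) x
      = poly_mapping.lookup (poly_mapping.lookup w l) x"
    by (auto simp: lookup_decompose lookup_component lookup_recompose elim!: Ints_cases)
qed

lemma decompose_add: "decompose (v + w) = decompose v + decompose w"
  by (intro poly_mapping_eqI) (simp add: lookup_decompose lookup_add lookup_component)

lemma decompose_scale:
  "decompose (pm_scale c v) = Poly_Mapping.mapp (\<lambda>_. pm_scale c) (decompose v)"
  by (intro poly_mapping_eqI)
    (simp add: lookup_mapp_zero lookup_decompose lookup_component)

lemma decompose_inner:
  "(\<Sum>l\<in>Poly_Mapping.keys (decompose v). pm_inner (component v l) (component w l)) = pm_inner v w"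
proof -
  define S where "S = Sigma (Poly_Mapping.keys (decompose v)) (\<lambda>l. Poly_Mapping.keys (component v l))"
  have S: "(l, x) \<in> S \<longleftrightarrow> x \<in> \<int> \<and> (l, \<lfloor>x\<rfloor>) \<in> Poly_Mapping.keys v" for l x
    unfolding S_def
    by (auto simp: in_keys_iff lookup_decompose lookup_component split: if_splits)
      (metis lookup_component lookup_zero)
  have "(\<Sum>l\<in>Poly_Mapping.keys (decompose v). pm_inner (component v l) (component w l))
      = (\<Sum>(l, x)\<in>S. poly_mapping.lookup (component v l) x
          * cnj (poly_mapping.lookup (component w l) x))"
    unfolding pm_inner_def S_def by (rule sum.Sigma) auto
  also have "\<dots> = pm_inner v w"
    unfolding pm_inner_def
    by (rule sum.reindex_bij_witness[where i = "\<lambda>(l, m). (l, of_int m)" and j = "\<lambda>(l, x). (l, \<lfloor>x\<rfloor>)"])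
      (auto simp: S lookup_component elim!: Ints_cases)
  finally show ?thesis .
qed

text \<open>Raising and lowering shift the weight by one, so a real weight \<open>x\<close> and the weights
  \<open>x \<plusminus> 1\<close> are integral together; off the integers both sides vanish.\<close>

lemma decompose_triple_act:
  "decompose (triple_act rho10_Hp rho10_Hm rho10_H3 a v)
    = Poly_Mapping.mapp (\<lambda>l. triple_act (pi_Hp (of_int l)) (pi_Hm (of_int l)) pi_H3 a) (decompose v)"
proof (rule poly_mapping_eqI)
  fix l
  let ?T = "\<lambda>l. triple_act (pi_Hp (of_int l)) (pi_Hm (of_int l)) pi_H3 a"
  have zero: "?T l 0 = 0" for l
    by (simp add: triple_act_def pi_Hp_def pi_Hm_def pi_H3_def lin_ext_def)
  have int: "x - 1 \<in> \<int> \<longleftrightarrow> x \<in> \<int>" "x + 1 \<in> \<int> \<longleftrightarrow> x \<in> \<int>" for x :: real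
    using Ints_add[of x 1] Ints_diff[of x 1] Ints_add[of "x - 1" 1] Ints_diff[of "x + 1" 1]
    by auto
  have "poly_mapping.lookup (component (triple_act rho10_Hp rho10_Hm rho10_H3 a v) l) x
      = poly_mapping.lookup (?T l (component v l)) x" for x
  proof (cases "x \<in> \<int>")
    case True
    then obtain m where "x = of_int m" by (elim Ints_cases)
    then show ?thesis
      by (simp add: lookup_component lookup_triple_act lookup_rho10 lookup_pi int csqrt_int_def)
  next
    case False
    then show ?thesis
      by (simp add: lookup_component lookup_triple_act lookup_pi int)
  qed
  then show "poly_mapping.lookup (decompose (triple_act rho10_Hp rho10_Hm rho10_H3 a v)) l
      = poly_mapping.lookup (Poly_Mapping.mapp ?T (decompose v)) l"
    by (simp add: lookup_mapp_zero zero lookup_decompose poly_mapping_eqI)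
qed

lemma bij_betw_decompose:
  "bij_betw decompose D10
    {w. Poly_Mapping.keys w \<subseteq> {1..} \<and> (\<forall>l\<in>{1..}. poly_mapping.lookup w l \<in> E_space (of_int l))}"
  (is "bij_betw _ _ ?C")
proof (rule bij_betw_byWitness[where f' = recompose])
  have supp: "\<exists>m. x = of_int m \<and> 1 \<le> l \<and> - l \<le> m \<and> m \<le> l"
    if "w \<in> ?C" "poly_mapping.lookup (poly_mapping.lookup w l) x \<noteq> 0" for w l x
  proof -
    have "l \<in> Poly_Mapping.keys w"
      using that(2) by (auto simp: in_keys_iff)
    with that(1) have "l \<ge> 1" by auto
    with that(1) have "Poly_Mapping.keys (poly_mapping.lookup w l) \<subseteq> of_int ` {- l..l}"
      by (auto simp: E_space_keys)
    moreover have "x \<in> Poly_Mapping.keys (poly_mapping.lookup w l)"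
      using that(2) by (simp add: in_keys_iff)
    ultimately obtain m where "x = of_int m" "m \<in> {- l..l}"
      by blast
    with \<open>l \<ge> 1\<close> show ?thesis by auto
  qed
  show "\<forall>v\<in>D10. recompose (decompose v) = v"
    by (simp add: recompose_decompose)
  show "\<forall>w\<in>?C. decompose (recompose w) = w"
  proof
    fix w assume w: "w \<in> ?C"
    have "Poly_Mapping.keys (poly_mapping.lookup w l) \<subseteq> \<int>" for l
    proof
      fix x assume "x \<in> Poly_Mapping.keys (poly_mapping.lookup w l)"
      with supp[OF w, of l x] show "x \<in> \<int>" by (auto simp: in_keys_iff)
    qed
    then show "decompose (recompose w) = w" by (rule decompose_recompose)
  qed
  show "recompose ` ?C \<subseteq> D10"
  proof (rule image_subsetI)
    fix w assume w: "w \<in> ?C"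
    have "1 \<le> l \<and> - l \<le> m \<and> m \<le> l"
      if "poly_mapping.lookup (recompose w) (l, m) \<noteq> 0" for l m
      using supp[OF w, of l "of_int m"] that by (auto simp: lookup_recompose)
    then show "recompose w \<in> D10"
      by (auto simp: D10_keys in_keys_iff)
  qed
  show "decompose ` D10 \<subseteq> ?C"
  proof (rule image_subsetI)
    fix v assume v: "v \<in> D10"
    have D: "1 \<le> l \<and> - l \<le> m \<and> m \<le> l" if "poly_mapping.lookup v (l, m) \<noteq> 0" for l m
      using v that by (auto simp: D10_keys subset_eq in_keys_iff)
    have "1 \<le> l" if "component v l \<noteq> 0" for l
    proof -
      from that obtain x where "poly_mapping.lookup (component v l) x \<noteq> 0"
        by (metis lookup_zero poly_mapping_eqI)
      then show ?thesis by (auto simp: lookup_component dest: D split: if_splits)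
    qed
    moreover have "component v l \<in> E_space (of_int l)" for l
    proof -
      have "x \<in> of_int ` {- l..l}" if "x \<in> Poly_Mapping.keys (component v l)" for x
        using that by (auto simp: in_keys_iff lookup_component dest: D
            elim!: Ints_cases split: if_splits)
      then show ?thesis by (auto simp: E_space_keys)
    qed
    ultimately show "decompose v \<in> ?C"
      by (auto simp: in_keys_iff lookup_decompose)
  qed
qed

theorem mainTheorem3:
  shows "restrict_rep so3 rho10 \<cong>\<^sub>u direct_sum {1::int..} (\<lambda>s. pi_rep (of_int s))"
    (is "?R \<cong>\<^sub>u ?S")
proof -
  have R: "alg ?R = so3" "carrier ?R = D10" "scale ?R = pm_scale" "inner_prod ?R = pm_inner"
    by (simp_all add: restrict_rep_def rho10_def)
  have S: "alg ?S = so3"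
    "carrier ?S = {w. Poly_Mapping.keys w \<subseteq> {1..} \<and>
       (\<forall>l\<in>{1..}. poly_mapping.lookup w l \<in> E_space (of_int l))}"
    "scale ?S = (\<lambda>c. Poly_Mapping.mapp (\<lambda>_. pm_scale c))"
    by (simp_all add: direct_sum_def pi_rep_def)
  have inner: "inner_prod ?S (decompose v) (decompose w) = pm_inner v w" for v w
    by (simp add: direct_sum_def pi_rep_def lookup_decompose decompose_inner)
  have act: "decompose (act ?R X v) = act ?S X (decompose v)" if "X \<in> so3" for X v
  proof -
    have "act ?R X v = triple_act rho10_Hp rho10_Hm rho10_H3 (fst X) v"
      using that by (simp add: restrict_rep_def rho10_def so3_eq triple_act_def)
    then show ?thesis
      by (simp add: decompose_triple_act direct_sum_def pi_rep_def)
  qed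
  show ?thesis
    unfolding unitarily_equivalent_def R S
    by (intro conjI exI[of _ decompose] ballI allI)
      (simp_all add: bij_betw_decompose decompose_add decompose_scale inner act)
qed

end
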